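(* Let $\mathscr{H}$ be a Hilbert space with $\dim\mathscr{H}\geq 2$, and let $M$ be an empirically adequate, line complete ontological model for $\mathscr{H}$, with ontic space $(\Lambda,\mathscr{L})$, set of experiments $\mathcal{EXP}$, and outcome distributions $P_{\lambda,\mathscr{E}}$ ($\lambda\in\Lambda$, $\mathscr{E}\in\mathcal{EXP}$). Then there is no experiment $\mathscr{G}\in\mathcal{EXP}$ whose value space is $(\Omega_{\mathscr{G}},\mathscr{F}_{\mathscr{G}})=(\Lambda,\mathscr{L})$ and which satisfies $$P_{\lambda,\mathscr{G}}(B)=1_{\lambda\in B}\qquad\text{for all }\lambda\in\Lambda\text{ and all }B\in\mathscr{L},$$ where $1_{\lambda\in B}$ equals $1$ if $\lambda\in B$ and $0$ otherwise.
   Context: Hilbert spaces are complex; $\mathbb{S}(\mathscr{H})=\{\psi\in\mathscr{H}:\|\psi\|=1\}$ is the unit sphere. POVM: a POVM on a measurable space $(\Omega,\mathscr{F})$ acting on $\mathscr{H}$ is a map $E$ assigning to every $B\in\mathscr{F}$ a positive (i.e., positive semidefinite) bounded operator $E(B)$ on $\mathscr{H}$ such that $E$ is countably additive on disjoint sets (in the weak sense: $B\mapsto\langle\psi|E(B)|\psi\rangle$ is a measure for every $\psi\in\mathscr{H}$) and $E(\Omega)=I$, the identity operator. Ontological model: an ontological model $M$ for (a quantum system with Hilbert space) $\mathscr{H}$ consists of (i) a set $\Lambda$ (the ontic space) with a sigma algebra $\mathscr{L}$; (ii) for every $\psi\in\mathbb{S}(\mathscr{H})$, a probability measure $\varrho^\psi$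 on $(\Lambda,\mathscr{L})$; (iii) an index set $\mathcal{EXP}$ (the set of possible experiments), where each $\mathscr{E}\in\mathcal{EXP}$ comes with a measurable value space $(\Omega_{\mathscr{E}},\mathscr{F}_{\mathscr{E}})$ of possible outcomes; (iv) a mapping associating with every $\mathscr{E}\in\mathcal{EXP}$ a POVM $E_{\mathscr{E}}$ on $(\Omega_{\mathscr{E}},\mathscr{F}_{\mathscr{E}})$ acting on $\mathscr{H}$; (v) for every $\lambda\in\Lambda$ and every $\mathscr{E}\in\mathcal{EXP}$, a probability measure $P_{\lambda,\mathscr{E}}$ on $(\Omega_{\mathscr{E}},\mathscr{F}_{\mathscr{E}})$, such that $\lambda\mapsto P_{\lambda,\mathscr{E}}(B)$ is a measurable function on $(\Lambda,\mathscr{L})$ for every $\mathscr{E}\in\mathcal{EXP}$ and $B\in\mathscr{F}_{\mathscr{E}}$. Empirically adequate: $M$ is empirically adequate if and only if for every $\psi\in\mathbb{S}(\mathscr{H})$, every $\mathscr{E}\in\mathcal{EXP}$, and every $B\in\mathscr{F}_{\mathscr{E}}$, $$\int_\Lambda \varrho^\psi(d\lambda)\,P_{\lambda,\mathscr{E}}(B)=\langle\psi|E_{\mathscr{E}}(B)|\psi\rangle.$$ Line complete: for a 1-dimensional subspace $g$ of $\mathscr{H}$, let $P_g$ be the orthogonal projection onto $g$, and let $F_g$ be the POVM on $\{0,1\}$ (with the power set as sigma algebra) given by $F_g(\{1\})=P_g$ and $F_g(\{0\})=I-P_g$. The model $M$ is line complete if for every 1-dimensional subspace $g$ of $\mathscr{H}$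 there is an experiment $\mathscr{E}\in\mathcal{EXP}$ (with value space $\{0,1\}$) such that $E_{\mathscr{E}}=F_g$. *)

theory Defs
  imports "HOL-Probability.Probability_Measure" "HOL-Library.Extended_Nat"
begin

section \<open>Complex Hilbert spaces\<close>

text \<open>
  The inner product is linear in its second argument. Since norms vanish only at \<open>0\<close>,
  the axiom \<open>cinner_self\<close> makes it positive definite and ties it to the norm, with respect
  to which the superclass \<open>banach\<close> requires completeness. No separability is assumed.
\<close>

class chilbert_space = banach +
  fixes scaleC :: "complex \<Rightarrow> 'a \<Rightarrow> 'a" (infixr \<open>*\<^sub>C\<close> 75)
    and cinner :: "'a \<Rightarrow> 'a \<Rightarrow> complex"
  assumes scaleC_add_right: "c *\<^sub>C (x + y) = c *\<^sub>C x + c *\<^sub>C y"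
    and scaleC_add_left: "(c + d) *\<^sub>C x = c *\<^sub>C x + d *\<^sub>C x"
    and scaleC_scaleC: "c *\<^sub>C d *\<^sub>C x = (c * d) *\<^sub>C x"
    and scaleC_one: "1 *\<^sub>C x = x"
    and scaleR_scaleC: "r *\<^sub>R x = complex_of_real r *\<^sub>C x"
    and cinner_commute: "cinner x y = cnj (cinner y x)"
    and cinner_add_right: "cinner x (y + z) = cinner x y + cinner x z"
    and cinner_scaleC_right: "cinner x (c *\<^sub>C y) = c * cinner x y"
    and cinner_self: "cinner x x = complex_of_real ((norm x)\<^sup>2)"

interpretation complex_vector: vector_space "scaleC :: complex \<Rightarrow> 'h \<Rightarrow> 'h::chilbert_space"
  by unfold_locales (fact scaleC_add_right scaleC_add_left scaleC_scaleC scaleC_one)+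

text \<open>
  The library's \<open>dim\<close> returns \<open>0\<close> on infinite-dimensional spaces; here these get
  dimension \<open>\<infinity>\<close>.
\<close>

definition cdim :: "'h::chilbert_space set \<Rightarrow> enat" where
  "cdim S = (if \<exists>B. finite B \<and> S \<subseteq> complex_vector.span B
             then enat (complex_vector.dim S) else \<infinity>)"

definition bounded_clinear :: "('h::chilbert_space \<Rightarrow> 'h) \<Rightarrow> bool" where
  "bounded_clinear T \<longleftrightarrow> bounded_linear T \<and> (\<forall>c x. T (c *\<^sub>C x) = c *\<^sub>C T x)"

definition positive_operator :: "('h::chilbert_space \<Rightarrow> 'h) \<Rightarrow> bool" where
  "positive_operator T \<longleftrightarrow> bounded_clinear T \<and> (\<forall>\<psi>. cinner \<psi> (T \<psi>) \<in> \<real>\<^sub>\<ge>\<^sub>0)"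

definition orth_proj :: "'h::chilbert_space set \<Rightarrow> 'h \<Rightarrow> 'h" where
  "orth_proj g \<psi> = (THE p. p \<in> g \<and> (\<forall>y\<in>g. cinner y (\<psi> - p) = 0))"


section \<open>POVMs\<close>

text \<open>
  A measurable space is represented by a value of type \<open>'u measure\<close>, of which only \<open>space\<close> and
  \<open>sets\<close> matter. The values \<open>E B\<close> for non-measurable \<open>B\<close> are irrelevant.
\<close>

definition povm :: "'u measure \<Rightarrow> ('u set \<Rightarrow> 'h::chilbert_space \<Rightarrow> 'h) \<Rightarrow> bool" where
  "povm \<Omega> E \<longleftrightarrow>
     (\<forall>B\<in>sets \<Omega>. positive_operator (E B)) \<and>
     (\<forall>\<psi>. measure_space (space \<Omega>) (sets \<Omega>) (\<lambda>B. ennreal (Re (cinner \<psi> (E B \<psi>))))) \<and>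
     E (space \<Omega>) = (\<lambda>\<psi>. \<psi>)"

text \<open>
  The two-outcome POVM on \<open>{0, 1}\<close> that sends \<open>{1}\<close> to the projection onto \<open>g\<close> and \<open>{0}\<close> to its
  complement, extended additively to \<open>{}\<close> and \<open>{0, 1}\<close>.
\<close>

definition line_povm :: "'h::chilbert_space set \<Rightarrow> 'u::zero_neq_one set \<Rightarrow> 'h \<Rightarrow> 'h" where
  "line_povm g B \<psi> =
     (if 1 \<in> B then orth_proj g \<psi> else 0) + (if 0 \<in> B then \<psi> - orth_proj g \<psi> else 0)"


section \<open>Ontological models\<close>

text \<open>
  The ontic space and the value spaces of the experiments are arbitrary subsets of an arbitrary
  common type \<open>'u\<close>, so that it makes sense to ask whether a value space equals the ontic space.
  The type carries two distinct constants \<open>0\<close> and \<open>1\<close>, and no further structure on it is used.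
  This is no restriction: any family of sets embeds into one such type.
\<close>

record ('h, 'u, 'e) model_data =
  ontic :: "'u measure"
  prep :: "'h \<Rightarrow> 'u measure"
  experiments :: "'e set"
  value_space :: "'e \<Rightarrow> 'u measure"
  povm_of :: "'e \<Rightarrow> 'u set \<Rightarrow> 'h \<Rightarrow> 'h"
  outcome_dist :: "'u \<Rightarrow> 'e \<Rightarrow> 'u measure"

definition ontological_model :: "('h::chilbert_space, 'u, 'e) model_data \<Rightarrow> bool" where
  "ontological_model M \<longleftrightarrow>
     (\<forall>\<psi>\<in>sphere 0 1. prob_space (prep M \<psi>) \<and> sets (prep M \<psi>) = sets (ontic M)) \<and>
     (\<forall>e\<in>experiments M. povm (value_space M e) (povm_of M e)) \<and>
     (\<forall>l\<in>space (ontic M). \<forall>e\<in>experiments M.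
        prob_space (outcome_dist M l e) \<and>
        sets (outcome_dist M l e) = sets (value_space M e)) \<and>
     (\<forall>e\<in>experiments M. \<forall>B\<in>sets (value_space M e).
        (\<lambda>l. measure (outcome_dist M l e) B) \<in> borel_measurable (ontic M))"

definition empirically_adequate :: "('h::chilbert_space, 'u, 'e) model_data \<Rightarrow> bool" where
  "empirically_adequate M \<longleftrightarrow>
     (\<forall>\<psi>\<in>sphere 0 1. \<forall>e\<in>experiments M. \<forall>B\<in>sets (value_space M e).
        complex_of_real (\<integral>l. measure (outcome_dist M l e) B \<partial>prep M \<psi>)
          = cinner \<psi> (povm_of M e B \<psi>))"

definition line_complete ::
    "('h::chilbert_space, 'u::zero_neq_one, 'e) model_data \<Rightarrow> bool" where
  "line_complete M \<longleftrightarrow>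
     (\<forall>g. complex_vector.subspace g \<and> cdim g = 1 \<longrightarrow>
        (\<exists>e\<in>experiments M.
           space (value_space M e) = {0, 1} \<and> sets (value_space M e) = Pow {0, 1} \<and>
           (\<forall>B\<in>Pow {0, 1}. povm_of M e B = line_povm g B)))"

end

theory Submission
  imports Defs
begin

text \<open>
  An experiment \<open>G\<close> that reveals the ontic state forces \<open>\<rho>\<^sup>\<psi>(B) = \<langle>\<psi>|G(B)|\<psi>\<rangle>\<close>, so \<open>\<psi> \<mapsto> \<rho>\<^sup>\<psi>(B)\<close>
  extends to a positive quadratic form. Let \<open>\<psi>\<close>, \<open>e\<close> be orthonormal, \<open>\<phi> = (\<psi> + e) / \<surd>2\<close> and
  \<open>\<phi>' = (\<psi> - e) / \<surd>2\<close>, and let \<open>f\<^sub>v(\<lambda>)\<close> be the probability of a positive answer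
  to the line experiment of \<open>v\<close>. On \<open>D = {f\<^sub>\<psi> > 0} \<inter> {f\<^sub>\<phi> > 0}\<close> the form vanishes at \<open>e\<close>, which is
  orthogonal to \<open>\<psi>\<close>, and at \<open>\<phi>'\<close>, which is orthogonal to \<open>\<phi>\<close>. By the parallelogram law the
  zeros of a positive form are closed under addition, so it vanishes at \<open>\<psi>\<close>, that is,
  \<open>\<rho>\<^sup>\<psi>(D) = 0\<close>. But \<open>f\<^sub>\<psi> = 1\<close> holds \<open>\<rho>\<^sup>\<psi>\<close>-almost surely, so \<open>f\<^sub>\<phi> = 0\<close> does as well, which
  contradicts \<open>\<integral>f\<^sub>\<phi> d\<rho>\<^sup>\<psi> = |\<langle>\<phi>|\<psi>\<rangle>|\<^sup>2 = 1/2\<close>.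
\<close>

lemma cinner_add_left: "cinner (x + y) z = cinner x z + cinner y (z::'h::chilbert_space)"
  by (metis cinner_add_right cinner_commute complex_cnj_add)

lemma cinner_scaleC_left: "cinner (c *\<^sub>C x) y = cnj c * cinner x (y::'h::chilbert_space)"
  by (metis cinner_commute cinner_scaleC_right complex_cnj_mult)

lemma cinner_diff_right: "cinner x (y - z) = cinner x y - cinner x (z::'h::chilbert_space)"
  by (metis add_diff_cancel_right' cinner_add_right diff_add_cancel)

lemma cinner_diff_left: "cinner (x - y) z = cinner x z - cinner y (z::'h::chilbert_space)"
  by (metis add_diff_cancel_right' cinner_add_left diff_add_cancel)

lemma cinner_zero_right [simp]: "cinner x (0::'h::chilbert_space) = 0"
  using cinner_diff_right[of x 0 0] by simp

lemma cinner_zero_left [simp]: "cinner 0 (x::'h::chilbert_space) = 0"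
  using cinner_diff_left[of 0 0 x] by simp

lemma cinner_scaleR_right: "cinner x (r *\<^sub>R y) = of_real r * cinner x (y::'h::chilbert_space)"
  by (simp add: scaleR_scaleC cinner_scaleC_right)

lemma cinner_scaleR_left: "cinner (r *\<^sub>R x) y = of_real r * cinner x (y::'h::chilbert_space)"
  by (simp add: scaleR_scaleC cinner_scaleC_left)

lemmas cinner_simps = cinner_add_left cinner_add_right cinner_diff_left cinner_diff_right
  cinner_scaleR_left cinner_scaleR_right cinner_scaleC_left cinner_scaleC_right

lemma mult_cinner_cinner_eq_norm:
  "cinner y x * cinner x y = of_real ((cmod (cinner x (y::'h::chilbert_space)))\<^sup>2)"
  by (metis cinner_commute complex_norm_square mult.commute of_real_power)

text \<open>This makes the definite description in \<open>orth_proj\<close> computable: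
  orthogonality tested against \<open>v\<close> itself already fixes the coefficient of any
  candidate \<open>k *\<^sub>C v\<close>.\<close>

lemma orth_proj_span_unit:
  fixes v :: "'h::chilbert_space"
  assumes "norm v = 1"
  shows "orth_proj (complex_vector.span {v}) x = cinner v x *\<^sub>C v"
  unfolding orth_proj_def
proof (rule the_equality)
  have vv: "cinner v v = 1" using assms by (simp add: cinner_self)
  then show "cinner v x *\<^sub>C v \<in> complex_vector.span {v} \<and>
      (\<forall>y\<in>complex_vector.span {v}. cinner y (x - cinner v x *\<^sub>C v) = 0)"
    by (auto simp: complex_vector.span_singleton cinner_simps)
  fix p assume p: "p \<in> complex_vector.span {v} \<and>
      (\<forall>y\<in>complex_vector.span {v}. cinner y (x - p) = 0)"
  then obtain k where k: "p = k *\<^sub>C v" by (auto simp: complex_vector.span_singleton)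
  have "cinner v (x - p) = 0" using p complex_vector.span_base[of v "{v}"] by auto
  then show "p = cinner v x *\<^sub>C v" using vv by (simp add: k cinner_simps)
qed

lemma cdim_span_singleton:
  assumes "v \<noteq> (0::'h::chilbert_space)"
  shows "cdim (complex_vector.span {v}) = 1"
proof -
  have "complex_vector.independent {v}" using assms by simp
  then have "complex_vector.dim (complex_vector.span {v}) = 1"
    by (simp add: complex_vector.dim_eq_card_independent)
  moreover have "\<exists>B. finite B \<and> complex_vector.span {v} \<subseteq> complex_vector.span B"
    by (intro exI[of _ "{v}"]) auto
  ultimately show ?thesis by (simp add: cdim_def one_enat_def)
qed

text \<open>A spanning singleton would make \<open>cdim\<close> finite and at most 1, so none
  exists, in infinite dimension as well. One Gram-Schmidt step then yields the pair.\<close>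

lemma exists_orthonormal_pair:
  assumes "2 \<le> cdim (UNIV :: 'h::chilbert_space set)"
  obtains x y :: "'h::chilbert_space" where "norm x = 1" "norm y = 1" "cinner x y = 0"
proof -
  have not_span: "complex_vector.span {z} \<noteq> UNIV" for z :: 'h
  proof
    assume sp: "complex_vector.span {z} = UNIV"
    then have "complex_vector.dim (UNIV :: 'h set) \<le> card {z}"
      by (intro complex_vector.dim_le_card) auto
    moreover have "\<exists>B. finite B \<and> (UNIV :: 'h set) \<subseteq> complex_vector.span B"
      using sp by (intro exI[of _ "{z}"]) auto
    ultimately have "cdim (UNIV :: 'h set) \<le> enat 1" by (simp add: cdim_def)
    with assms have "(2::enat) \<le> enat 1" by (rule order_trans)
    then show False by (simp add: numeral_eq_enat)
  qed
  \<comment> \<open>The span of \<open>{0}\<close> is not everything, so a nonzero vector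
    exists.\<close>
  obtain u :: 'h where u: "u \<noteq> 0"
    using not_span[of 0] complex_vector.span_zero by fastforce
  define x where "x = (1 / norm u) *\<^sub>R u"
  have nx: "norm x = 1" using u by (simp add: x_def)
  obtain w where w: "w \<notin> complex_vector.span {x}" using not_span[of x] by auto
  define z where "z = w - cinner x w *\<^sub>C x"
  have z: "z \<noteq> 0" using w by (auto simp: z_def complex_vector.span_singleton)
  have "cinner x z = 0" using nx by (simp add: z_def cinner_simps cinner_self)
  then have "cinner x ((1 / norm z) *\<^sub>R z) = 0" by (simp add: cinner_simps)
  moreover have "norm ((1 / norm z) *\<^sub>R z) = 1" using z by simp
  ultimately show ?thesis using that nx by blast
qed

text \<open>Adding the values of the form at \<open>x + y\<close> and \<open>x - y\<close> cancels
  the cross terms, so two nonnegative numbers sum to 0 and both vanish.\<close>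

lemma positive_operator_zero_add:
  fixes T :: "'h::chilbert_space \<Rightarrow> 'h"
  assumes "positive_operator T" and "cinner x (T x) = 0" and "cinner y (T y) = 0"
  shows "cinner (x + y) (T (x + y)) = 0"
proof -
  have T: "bounded_linear T"
    using assms(1) by (auto simp: positive_operator_def bounded_clinear_def)
  have nn: "cinner z (T z) \<in> \<real>\<^sub>\<ge>\<^sub>0" for z
    using assms(1) by (auto simp: positive_operator_def)
  have "cinner (x + y) (T (x + y)) + cinner (x - y) (T (x - y)) = 0"
    using assms(2,3)
    by (simp add: linear_add linear_diff bounded_linear.linear[OF T] cinner_simps)
  with nn[of "x + y"] nn[of "x - y"] show ?thesis
    by (auto simp: complex_nonneg_Reals_iff complex_eq_iff)
qed

lemma positive_operator_zero_scaleR: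
  fixes T :: "'h::chilbert_space \<Rightarrow> 'h"
  assumes "positive_operator T" and "cinner x (T x) = 0"
  shows "cinner (r *\<^sub>R x) (T (r *\<^sub>R x)) = 0"
proof -
  have T: "bounded_linear T"
    using assms(1) by (auto simp: positive_operator_def bounded_clinear_def)
  show ?thesis
    using assms(2) by (simp add: linear_scale bounded_linear.linear[OF T] cinner_simps)
qed

text \<open>Extracts the response function of the line through \<open>v\<close>. The essential point
  is the order of quantifiers: one \<open>f\<close> serves every preparation
  \<open>x\<close>.\<close>

lemma line_experiment:
  fixes M :: "('h::chilbert_space, 'u::zero_neq_one, 'e) model_data"
  assumes om: "ontological_model M"
    and ea: "empirically_adequate M"
    and lc: "line_complete M"
    and v: "norm v = 1"
  obtains f where "f \<in> borel_measurable (ontic M)"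
    and "\<And>l. l \<in> space (ontic M) \<Longrightarrow> 0 \<le> f l \<and> f l \<le> (1::real)"
    and "\<And>x. norm x = 1 \<Longrightarrow> (\<integral>l. f l \<partial>prep M x) = (cmod (cinner v x))\<^sup>2"
proof -
  let ?g = "complex_vector.span {v}"
  have "complex_vector.subspace ?g \<and> cdim ?g = 1"
    using v by (auto intro: cdim_span_singleton)
  then obtain e where e: "e \<in> experiments M" "sets (value_space M e) = Pow {0, 1}"
    "\<forall>B\<in>Pow {0, 1}. povm_of M e B = line_povm ?g B"
    using lc[unfolded line_complete_def, rule_format, of ?g] by auto
  let ?f = "\<lambda>l. measure (outcome_dist M l e) {1}"
  have in1: "{1} \<in> sets (value_space M e)" by (simp add: e)
  show ?thesis
  proof
    show "?f \<in> borel_measurable (ontic M)"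
      using om e(1) in1 by (auto simp: ontological_model_def)
    show "0 \<le> ?f l \<and> ?f l \<le> 1" if "l \<in> space (ontic M)" for l
      using om e(1) that
      by (auto simp: ontological_model_def intro: prob_space.prob_le_1)
    fix x :: 'h assume x: "norm x = 1"
    have "complex_of_real (\<integral>l. ?f l \<partial>prep M x) = cinner x (povm_of M e {1} x)"
      using ea e(1) in1 x by (auto simp: empirically_adequate_def)
    \<comment> \<open>Since \<open>0\<close> and \<open>1\<close> are distinct, the complement term
      of \<open>line_povm\<close> drops out at \<open>{1}\<close>.\<close>
    also have "povm_of M e {1} x = cinner v x *\<^sub>C v"
      using e(3) by (simp add: line_povm_def orth_proj_span_unit[OF v])
    also have "cinner x (cinner v x *\<^sub>C v) = of_real ((cmod (cinner v x))\<^sup>2)"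
      by (metis cinner_scaleC_right mult.commute mult_cinner_cinner_eq_norm)
    finally show "(\<integral>l. ?f l \<partial>prep M x) = (cmod (cinner v x))\<^sup>2"
      by (simp only: of_real_eq_iff)
  qed
qed

text \<open>The bounds secure integrability; without it the integral could be 0 merely by
  convention.\<close>

lemma (in prob_space) AE_eq_zero_of_integral_eq_zero:
  fixes f :: "'a \<Rightarrow> real"
  assumes "f \<in> borel_measurable M" and "\<And>x. x \<in> space M \<Longrightarrow> 0 \<le> f x \<and> f x \<le> 1"
    and "(\<integral>x. f x \<partial>M) = 0"
  shows "AE x in M. f x = 0"
proof -
  have "integrable M f"
    using assms by (intro integrable_const_bound[where B=1]) auto
  moreover have "AE x in M. 0 \<le> f x" using assms(2) by auto
  ultimately show ?thesis using assms(3) by (simp add: integral_nonneg_eq_0_iff_AE)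
qed

theorem theorem1:
  fixes M :: "('h::chilbert_space, 'u::zero_neq_one, 'e) model_data"
  assumes "2 \<le> cdim (UNIV :: 'h set)"
    and "ontological_model M"
    and "empirically_adequate M"
    and "line_complete M"
  shows "\<not> (\<exists>G\<in>experiments M.
           space (value_space M G) = space (ontic M) \<and>
           sets (value_space M G) = sets (ontic M) \<and>
           (\<forall>l\<in>space (ontic M). \<forall>B\<in>sets (ontic M).
              measure (outcome_dist M l G) B = (if l \<in> B then 1 else 0)))"
proof
  assume "\<exists>G\<in>experiments M.
           space (value_space M G) = space (ontic M) \<and>
           sets (value_space M G) = sets (ontic M) \<and>
           (\<forall>l\<in>space (ontic M). \<forall>B\<in>sets (ontic M).
              measure (outcome_dist M l G) B = (if l \<in> B then 1 else 0))"
  then obtain G where G: "G \<in> experiments M" "sets (value_space M G) = sets (ontic M)"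
    and dirac: "\<And>l B. l \<in> space (ontic M) \<Longrightarrow> B \<in> sets (ontic M) \<Longrightarrow>
              measure (outcome_dist M l G) B = (if l \<in> B then 1 else 0)"
    by blast
  have prob: "prob_space (prep M x)"
    and sets_prep: "sets (prep M x) = sets (ontic M)" if "norm x = 1" for x
    using assms(2) that by (auto simp: ontological_model_def)
  have space_prep: "space (prep M x) = space (ontic M)" if "norm x = 1" for x
    using sets_prep[OF that] by (rule sets_eq_imp_space_eq)
  have meas_prep: "f \<in> borel_measurable (prep M x)"
    if "norm x = 1" "f \<in> borel_measurable (ontic M)" for x and f :: "'u \<Rightarrow> real"
    using that(2) measurable_cong_sets[OF sets_prep[OF that(1)] refl] by blast
  have prep_eq: "complex_of_real (measure (prep M x) B) = cinner x (povm_of M G B x)"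
    if x: "norm x = 1" and B: "B \<in> sets (ontic M)" for x B
  proof -
    \<comment> \<open>The outcome distributions of \<open>G\<close> are point masses, so the
      integrand of empirical adequacy is the indicator of \<open>B\<close>.\<close>
    have "(\<integral>l. measure (outcome_dist M l G) B \<partial>prep M x) = (\<integral>l. indicator B l \<partial>prep M x)"
      using dirac B by (intro Bochner_Integration.integral_cong) (auto simp: space_prep[OF x])
    also have "\<dots> = measure (prep M x) B"
      using sets.sets_into_space[OF B] by (simp add: space_prep[OF x] Int_absorb2)
    finally show ?thesis
      using assms(3)[unfolded empirically_adequate_def, rule_format, of x G B] G x B by simp
  qed
  obtain \<psi> e :: 'h where \<psi>: "norm \<psi> = 1" and e: "norm e = 1" and \<psi>e: "cinner \<psi> e = 0"
    using exists_orthonormal_pair[OF assms(1)] by blast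
  have e\<psi>: "cinner e \<psi> = 0" using \<psi>e by (metis cinner_commute complex_cnj_zero)
  have self: "cinner \<psi> \<psi> = 1" "cinner e e = 1" using \<psi> e by (auto simp: cinner_self)
  define \<phi> where "\<phi> = (1 / sqrt 2) *\<^sub>R (\<psi> + e)"
  define \<phi>' where "\<phi>' = (1 / sqrt 2) *\<^sub>R (\<psi> - e)"
  have unit: "norm x = 1" if "cinner x x = 1" for x :: 'h
    using that by (simp add: cinner_self power2_eq_1_iff flip: of_real_power)
      (use norm_ge_zero[of x] in linarith)
  have \<phi>: "norm \<phi> = 1" and \<phi>': "norm \<phi>' = 1"
    by (rule unit; simp add: \<phi>_def \<phi>'_def cinner_simps self \<psi>e e\<psi> flip: of_real_mult)+
  have \<phi>\<phi>': "cinner \<phi> \<phi>' = 0"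
    by (simp add: \<phi>_def \<phi>'_def cinner_simps self \<psi>e e\<psi>)
  have \<phi>\<psi>: "cinner \<phi> \<psi> \<noteq> 0"
    by (simp add: \<phi>_def cinner_simps self e\<psi>)
  obtain f where f: "f \<in> borel_measurable (ontic M)"
    "\<And>l. l \<in> space (ontic M) \<Longrightarrow> 0 \<le> f l \<and> f l \<le> (1::real)"
    "\<And>x. norm x = 1 \<Longrightarrow> (\<integral>l. f l \<partial>prep M x) = (cmod (cinner \<psi> x))\<^sup>2"
    using line_experiment[OF assms(2-4) \<psi>] by metis
  obtain h where h: "h \<in> borel_measurable (ontic M)"
    "\<And>l. l \<in> space (ontic M) \<Longrightarrow> 0 \<le> h l \<and> h l \<le> (1::real)"
    "\<And>x. norm x = 1 \<Longrightarrow> (\<integral>l. h l \<partial>prep M x) = (cmod (cinner \<phi> x))\<^sup>2"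
    using line_experiment[OF assms(2-4) \<phi>] by metis
  define D where "D = {l \<in> space (ontic M). 0 < f l \<and> 0 < h l}"
  have D: "D \<in> sets (ontic M)" unfolding D_def using f(1) h(1) by measurable
  have pos: "positive_operator (povm_of M G D)"
    using assms(2) G D by (auto simp: ontological_model_def povm_def)
  \<comment> \<open>The disjunction covers both uses: \<open>f\<close> vanishes almost surely under
    \<open>e\<close>, and \<open>h\<close> under \<open>\<phi>'\<close>.\<close>
  have null: "cinner x (povm_of M G D x) = 0"
    if x: "norm x = 1" and AE: "AE l in prep M x. f l = 0 \<or> h l = 0" for x
  proof -
    have "AE l in prep M x. l \<notin> D" using AE by eventually_elim (auto simp: D_def)
    then have "measure (prep M x) D = 0"
      using prob_space.prob_eq_0[OF prob[OF x]] D by (simp add: sets_prep[OF x])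
    then show ?thesis using prep_eq[OF x D] by simp
  qed
  have AE_zero: "AE l in prep M x. k l = 0"
    if "norm x = 1" "k \<in> borel_measurable (ontic M)"
      "\<And>l. l \<in> space (ontic M) \<Longrightarrow> 0 \<le> k l \<and> k l \<le> 1" "(\<integral>l. k l \<partial>prep M x) = 0"
    for x and k :: "'u \<Rightarrow> real"
    using prob_space.AE_eq_zero_of_integral_eq_zero[OF prob] that meas_prep space_prep by metis
  have "AE l in prep M e. f l = 0" using f \<psi>e e by (intro AE_zero) auto
  then have qe: "cinner e (povm_of M G D e) = 0" using e by (intro null) auto
  have "AE l in prep M \<phi>'. h l = 0" using h \<phi>\<phi>' \<phi>' by (intro AE_zero) auto
  then have q\<phi>': "cinner \<phi>' (povm_of M G D \<phi>') = 0" using \<phi>' by (intro null) auto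
  \<comment> \<open>Rescaling \<open>\<phi>'\<close> gives \<open>\<psi> - e\<close>, so the two
    zeros of the form add up to \<open>\<psi>\<close>.\<close>
  have "sqrt 2 *\<^sub>R \<phi>' + e = \<psi>" by (simp add: \<phi>'_def)
  with positive_operator_zero_add[OF pos positive_operator_zero_scaleR[OF pos q\<phi>'] qe,
      of "sqrt 2"]
  have "cinner \<psi> (povm_of M G D \<psi>) = 0" by (simp only:)
  then have "measure (prep M \<psi>) D = 0" using prep_eq[OF \<psi> D] by simp
  interpret P: prob_space "prep M \<psi>" using \<psi> by (rule prob)
  have notD: "AE l in prep M \<psi>. l \<notin> D"
    using \<open>measure (prep M \<psi>) D = 0\<close> D P.prob_eq_0 by (simp add: sets_prep[OF \<psi>])
  \<comment> \<open>Under \<open>\<psi>\<close> the function \<open>f\<close> has mean 1 and is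
    bounded by 1, so the nonnegative gap \<open>1 - f\<close> has integral 0.\<close>
  have "AE l in prep M \<psi>. 1 - f l = 0"
  proof (rule AE_zero[OF \<psi>])
    have "integrable (prep M \<psi>) f"
      using f(2) meas_prep[OF \<psi> f(1)]
      by (intro P.integrable_const_bound[where B=1]) (auto simp: space_prep[OF \<psi>])
    then show "(\<integral>l. 1 - f l \<partial>prep M \<psi>) = 0"
      using f(3)[OF \<psi>] self by (simp add: P.prob_space)
  qed (use f(1,2) in auto)
  \<comment> \<open>Where \<open>f\<close> is 1, being outside \<open>D\<close> rules out
    \<open>h > 0\<close>, and \<open>h\<close> is nonnegative.\<close>
  with notD have "AE l in prep M \<psi>. h l = 0"
    using AE_space
    by eventually_elim (use h(2) in \<open>force simp: D_def space_prep[OF \<psi>]\<close>)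
  then have "(\<integral>l. h l \<partial>prep M \<psi>) = 0" by (rule integral_eq_zero_AE)
  then show False using h(3)[OF \<psi>] \<phi>\<psi> by simp
qed

end
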